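(* Let $d_3\in\mathbb R\setminus\{\pm1\}$ and $d_4\in\mathbb R$. The rotational hypersurface in $\mathbb E_1^4$ parametrized by $$\Gamma^{t}(s,t,w)=\left(d_3s+d_4,\ -s\cos t\sin w,\ -s\sin t,\ s\cos t\cos w\right),\qquad s\in\mathbb R\setminus\{0\},\ 0\le t,w\le2\pi,$$ has $L_2$-harmonic Gauss map, i.e. its unit normal vector field $N$ satisfies $L_2N=0$.
   Context: $\mathbb E_1^4$ is $\mathbb R^4$ with the Lorentzian metric $\langle\,,\rangle=-dx_1^2+dx_2^2+dx_3^2+dx_4^2$. Let $M$ be an oriented hypersurface of $\mathbb E_1^4$ with nondegenerate induced metric $g$, unit normal vector field (Gauss map) $N$, $\varepsilon=\langle N,N\rangle=\pm1$, shape operator $S=-dN$ and principal curvatures $\kappa_1,\kappa_2,\kappa_3$. Put $a_0=1$, $a_1=-(\kappa_1+\kappa_2+\kappa_3)$, $a_2=\kappa_1\kappa_2+\kappa_1\kappa_3+\kappa_2\kappa_3$, $a_3=-\kappa_1\kappa_2\kappa_3$. The Newton transformations are $P_0=I$, $P_k=a_kI+S\circ P_{k-1}$, and $L_k(\varphi)=\mathrm{tr}(P_k\circ\nabla^2\varphi)$ for $\varphi\in C^\infty(M)$, where $\nabla^2\varphi$ is the Hessian operator of $\varphi$ with respect to $g$; $L_k$ acts componentwise on $\mathbb R^4$-valued functions such as $N$. With $n=3$, $\binom{n}{k}H_k=(-\varepsilon)^ka_k$ and $C_k=\binom{n}{k+1}(-\varepsilon)^k$, the known formula used for the Gauss map is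 $L_kN=-\varepsilon C_k\big(\nabla H_{k+1}+(nH_1H_{k+1}-(n-k-1)H_{k+2})N\big)$, where $\nabla$ is the gradient of $g$ (for $k=2$ the last term has coefficient $0$). The parametrization is considered where it is an immersion ($\cos t\neq0$). *)

theory Defs
  imports "HOL-Analysis.Analysis" "HOL-Computational_Algebra.Fundamental_Theorem_Algebra"
begin

section \<open>Calculus on the parameter domain\<close>

definition pd :: "3 \<Rightarrow> (real^3 \<Rightarrow> 'b::real_normed_vector) \<Rightarrow> real^3 \<Rightarrow> 'b" where
  "pd i f p = frechet_derivative f (at p) (axis i 1)"

primrec Ck_on :: "nat \<Rightarrow> (real^3) set \<Rightarrow> (real^3 \<Rightarrow> 'b::real_normed_vector) \<Rightarrow> bool" where
  "Ck_on 0 U f \<longleftrightarrow> continuous_on U f"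
| "Ck_on (Suc k) U f \<longleftrightarrow> (\<forall>p\<in>U. f differentiable at p) \<and> (\<forall>i. Ck_on k U (pd i f))"

text \<open>Only meant for open \<^term>\<open>U\<close>.\<close>

definition smooth_on :: "(real^3) set \<Rightarrow> (real^3 \<Rightarrow> 'b::real_normed_vector) \<Rightarrow> bool" where
  "smooth_on U f \<longleftrightarrow> (\<forall>k. Ck_on k U f)"

section \<open>Parametrized hypersurfaces of Lorentz--Minkowski 4-space\<close>

text \<open>A hypersurface is given by a parametrization \<open>X\<close>. Tangent vectors are written in the
  coordinate basis \<open>pd 1 X p, pd 2 X p, pd 3 X p\<close>, and an endomorphism \<open>T\<close> of the tangent space is
  the matrix \<open>A\<close> with \<open>T (pd j X p) = (\<Sum>i. A $ i $ j *\<^sub>R pd i X p)\<close>.\<close>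

definition lorentz :: "real^4 \<Rightarrow> real^4 \<Rightarrow> real" where
  "lorentz x y = - x$1 * y$1 + x$2 * y$2 + x$3 * y$3 + x$4 * y$4"

definition metric :: "(real^3 \<Rightarrow> real^4) \<Rightarrow> real^3 \<Rightarrow> real^3^3" where
  "metric X p = (\<chi> i j. lorentz (pd i X p) (pd j X p))"

definition nondegenerate_immersion :: "(real^3 \<Rightarrow> real^4) \<Rightarrow> (real^3) set \<Rightarrow> bool" where
  "nondegenerate_immersion X U \<longleftrightarrow> smooth_on U X \<and>
     (\<forall>p\<in>U. inj (frechet_derivative X (at p)) \<and> invertible (metric X p))"

definition unit_normal_field ::
    "(real^3 \<Rightarrow> real^4) \<Rightarrow> (real^3) set \<Rightarrow> (real^3 \<Rightarrow> real^4) \<Rightarrow> bool" where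
  "unit_normal_field X U N \<longleftrightarrow> smooth_on U N \<and>
     (\<forall>p\<in>U. (\<forall>i. lorentz (N p) (pd i X p) = 0) \<and> lorentz (N p) (N p) \<in> {1, -1})"

text \<open>The parameter set \<open>D\<close> need not be open (for instance, a closed range of angles), so smoothness
  on \<open>D\<close> means smoothness on an open neighbourhood.\<close>

definition gauss_map :: "(real^3 \<Rightarrow> real^4) \<Rightarrow> (real^3) set \<Rightarrow> (real^3 \<Rightarrow> real^4) \<Rightarrow> bool" where
  "gauss_map X D N \<longleftrightarrow>
     (\<exists>U. open U \<and> D \<subseteq> U \<and> nondegenerate_immersion X U \<and> unit_normal_field X U N)"

text \<open>\<open>S = - dN\<close>; the matrix is unique wherever \<open>X\<close> is an immersion.\<close>

definition shape_operator ::
    "(real^3 \<Rightarrow> real^4) \<Rightarrow> (real^3 \<Rightarrow> real^4) \<Rightarrow> real^3 \<Rightarrow> real^3^3" where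
  "shape_operator X N p =
     (THE A. \<forall>j. - pd j N p = (\<Sum>i\<in>UNIV. A $ i $ j *\<^sub>R pd i X p))"

section \<open>Principal curvatures and Newton transformations\<close>

text \<open>For an indefinite metric the shape operator may have non-real eigenvalues. The principal
  curvatures are therefore listed as the complex eigenvalues with algebraic multiplicity, in
  some order; the coefficients below are symmetric in them and real.\<close>

definition principal_curvatures :: "real^3^3 \<Rightarrow> complex^3" where
  "principal_curvatures A = (SOME \<kappa>. \<forall>z.
     det (mat z - (\<chi> i j. complex_of_real (A $ i $ j))) = (\<Prod>i\<in>UNIV. z - \<kappa> $ i))"

definition a_coeff :: "real^3^3 \<Rightarrow> nat \<Rightarrow> real" where
  "a_coeff A k = (let \<kappa> = principal_curvatures A in Re (
     if k = 0 then 1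
     else if k = 1 then - (\<kappa>$1 + \<kappa>$2 + \<kappa>$3)
     else if k = 2 then \<kappa>$1 * \<kappa>$2 + \<kappa>$1 * \<kappa>$3 + \<kappa>$2 * \<kappa>$3
     else if k = 3 then - (\<kappa>$1 * \<kappa>$2 * \<kappa>$3)
     else 0))"

primrec newton_transformation :: "nat \<Rightarrow> real^3^3 \<Rightarrow> real^3^3" where
  "newton_transformation 0 A = mat 1"
| "newton_transformation (Suc k) A =
     a_coeff A (Suc k) *\<^sub>R mat 1 + A ** newton_transformation k A"

section \<open>Hessian operator and the operators \<open>L\<^sub>k\<close>\<close>

definition gradient :: "(real^3 \<Rightarrow> real^4) \<Rightarrow> (real^3 \<Rightarrow> real) \<Rightarrow> real^3 \<Rightarrow> real^3" where
  "gradient X \<phi> p = matrix_inv (metric X p) *v (\<chi> j. pd j \<phi> p)"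

text \<open>\<open>christoffel X i j l\<close> is the Christoffel symbol with upper index \<open>i\<close> and lower
  indices \<open>j\<close>, \<open>l\<close>.\<close>

definition christoffel :: "(real^3 \<Rightarrow> real^4) \<Rightarrow> 3 \<Rightarrow> 3 \<Rightarrow> 3 \<Rightarrow> real^3 \<Rightarrow> real" where
  "christoffel X i j l p = (\<Sum>m\<in>UNIV. matrix_inv (metric X p) $ i $ m *
     (pd j (\<lambda>q. metric X q $ m $ l) p + pd l (\<lambda>q. metric X q $ j $ m) p
        - pd m (\<lambda>q. metric X q $ j $ l) p)) / 2"

definition cov_deriv ::
    "(real^3 \<Rightarrow> real^4) \<Rightarrow> 3 \<Rightarrow> (real^3 \<Rightarrow> real^3) \<Rightarrow> real^3 \<Rightarrow> real^3" where
  "cov_deriv X j V p =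
     (\<chi> i. pd j (\<lambda>q. V q $ i) p + (\<Sum>l\<in>UNIV. christoffel X i j l p * V p $ l))"

definition hessian_operator ::
    "(real^3 \<Rightarrow> real^4) \<Rightarrow> (real^3 \<Rightarrow> real) \<Rightarrow> real^3 \<Rightarrow> real^3^3" where
  "hessian_operator X \<phi> p = (\<chi> i j. cov_deriv X j (gradient X \<phi>) p $ i)"

definition L_op :: "nat \<Rightarrow> (real^3 \<Rightarrow> real^4) \<Rightarrow> (real^3 \<Rightarrow> real^4) \<Rightarrow>
    (real^3 \<Rightarrow> real) \<Rightarrow> real^3 \<Rightarrow> real" where
  "L_op k X N \<phi> p =
     trace (newton_transformation k (shape_operator X N p) ** hessian_operator X \<phi> p)"

definition L_vec :: "nat \<Rightarrow> (real^3 \<Rightarrow> real^4) \<Rightarrow> (real^3 \<Rightarrow> real^4) \<Rightarrow>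
    (real^3 \<Rightarrow> real^4) \<Rightarrow> real^3 \<Rightarrow> real^4" where
  "L_vec k X N F p = (\<chi> c. L_op k X N (\<lambda>q. F q $ c) p)"

section \<open>The rotational hypersurface\<close>

text \<open>The parameters \<open>(s, t, w)\<close> are the three coordinates of \<open>p\<close>.\<close>

definition Gamma_t :: "real \<Rightarrow> real \<Rightarrow> real^3 \<Rightarrow> real^4" where
  "Gamma_t d3 d4 p = (let s = p$1; t = p$2; w = p$3 in
     vector [d3 * s + d4, - s * cos t * sin w, - s * sin t, s * cos t * cos w])"

definition Gamma_dom :: "(real^3) set" where
  "Gamma_dom = {p. p$1 \<noteq> 0 \<and> p$2 \<in> {0..2*pi} \<and> p$3 \<in> {0..2*pi} \<and> cos (p$2) \<noteq> 0}"

section \<open>The principal curvatures are well defined\<close>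

lemma prod_UNIV_3: "(\<Prod>i\<in>(UNIV::3 set). f i) = f 1 * f 2 * f 3"
  unfolding UNIV_3 by (simp add: ac_simps)

lemma ex_monic_cubic_roots:
  fixes b c d :: complex
  shows "\<exists>\<kappa>::complex^3. \<forall>z. z^3 + b * z^2 + c * z + d = (\<Prod>i\<in>UNIV. z - \<kappa> $ i)"
proof -
  let ?p = "[:d, c, b, 1:]"
  have "degree ?p = 3" "lead_coeff ?p = 1" "?p \<noteq> 0"
    by simp_all
  then obtain R where R: "size R = 3" "?p = (\<Prod>x\<in>#R. [:-x, 1:])"
    using alg_closed_imp_factorization[of ?p] by (metis smult_1_left)
  obtain k1 R1 where R1: "R = add_mset k1 R1" "size R1 = 2"
    using size_eq_Suc_imp_eq_union[of R 2] R(1) by auto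
  obtain k2 R2 where R2: "R1 = add_mset k2 R2" "size R2 = 1"
    using size_eq_Suc_imp_eq_union[of R1 1] R1(2) by auto
  obtain k3 where "R2 = {#k3#}"
    using R2(2) size_1_singleton_mset by blast
  then have k: "R = {#k1, k2, k3#}"
    using R1(1) R2(1) by simp
  have p: "?p = [:-k1, 1:] * ([:-k2, 1:] * [:-k3, 1:])"
    using R(2) unfolding k by simp
  show ?thesis
  proof (intro exI allI)
    fix z
    have "poly ?p z = (z - k1) * (z - k2) * (z - k3)"
      unfolding p by (simp only: poly_mult) simp
    then show "z^3 + b * z^2 + c * z + d = (\<Prod>i\<in>UNIV. z - (vector [k1, k2, k3] :: complex^3) $ i)"
      by (simp add: prod_UNIV_3 power3_eq_cube power2_eq_square algebra_simps)
  qed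
qed

lemma principal_curvatures_charpoly:
  "det (mat z - (\<chi> i j. complex_of_real (A $ i $ j))) = (\<Prod>i\<in>UNIV. z - principal_curvatures A $ i)"
proof -
  let ?C = "\<chi> i j. complex_of_real (A $ i $ j)"
  have "\<exists>b c d. \<forall>z. det (mat z - ?C) = z^3 + b * z^2 + c * z + d"
  proof (intro exI allI)
    fix z
    show "det (mat z - ?C) = z^3 + (- ?C$1$1 - ?C$2$2 - ?C$3$3) * z^2
      + (?C$1$1 * ?C$2$2 - ?C$1$2 * ?C$2$1 + ?C$1$1 * ?C$3$3 - ?C$1$3 * ?C$3$1
         + ?C$2$2 * ?C$3$3 - ?C$2$3 * ?C$3$2) * z + - det ?C"
      by (simp add: det_3 mat_def algebra_simps power3_eq_cube power2_eq_square)
  qed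
  then have "\<exists>\<kappa>::complex^3. \<forall>z. det (mat z - ?C) = (\<Prod>i\<in>UNIV. z - \<kappa> $ i)"
    using ex_monic_cubic_roots by metis
  from someI_ex[OF this] show ?thesis
    unfolding principal_curvatures_def by blast
qed

lemma charpoly_a_coeff:
  "det (mat x - A) = x^3 + a_coeff A 1 * x^2 + a_coeff A 2 * x + a_coeff A 3"
proof -
  let ?k = "principal_curvatures A"
  have *: "complex_of_real (det (mat x - A)) =
      det (mat (of_real x) - (\<chi> i j. complex_of_real (A $ i $ j)))"
    by (simp add: det_3 mat_def)
  have "complex_of_real (det (mat x - A)) = of_real (x^3)
      + of_real (x^2) * (- (?k$1 + ?k$2 + ?k$3))
      + of_real x * (?k$1 * ?k$2 + ?k$1 * ?k$3 + ?k$2 * ?k$3)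
      + (- (?k$1 * ?k$2 * ?k$3))"
    unfolding * principal_curvatures_charpoly
    by (simp add: prod_UNIV_3 power3_eq_cube power2_eq_square algebra_simps)
  from arg_cong[where f = Re, OF this]
  have "det (mat x - A) = x^3 + x^2 * Re (- (?k$1 + ?k$2 + ?k$3))
      + x * Re (?k$1 * ?k$2 + ?k$1 * ?k$3 + ?k$2 * ?k$3) + Re (- (?k$1 * ?k$2 * ?k$3))"
    by (simp only: plus_complex.sel Re_complex_of_real times_complex.sel Im_complex_of_real mult_zero_left diff_zero)
  then show ?thesis
    by (simp add: a_coeff_def Let_def mult.commute)
qed

end

theory Submission
  imports Defs
begin

text \<open>Write \<open>X = (d3 s + d4, s Y)\<close> with \<open>Y\<close> on the unit sphere: the hypersurface is a cone. Its
  unit normal is \<open>N = a (1, d3 Y)\<close> with a locally constant \<open>a\<close>, so \<open>S = diag(0, k, k)\<close> with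
  \<open>k = - a d3 / s\<close>, and \<open>P\<^sub>2 = diag(k\<^sup>2, 0, 0)\<close>. Hence \<open>L\<^sub>2\<close> only sees the
  \<open>(s, s)\<close> entry of the Hessian operator, which vanishes on functions that are independent of \<open>s\<close>
  because \<open>g\<close> is diagonal with constant entry \<open>g\<^sub>s\<^sub>s\<close>.\<close>

section \<open>Partial derivatives\<close>

lemma has_derivative_vec_nth_iff:
  fixes f :: "'a::real_normed_vector \<Rightarrow> real^'n"
  shows "(f has_derivative f') (at p) \<longleftrightarrow> (\<forall>c. ((\<lambda>q. f q $ c) has_derivative (\<lambda>h. f' h $ c)) (at p))"
proof -
  have "(f has_derivative f') (at p) \<longleftrightarrow>
      (\<forall>i\<in>Basis. ((\<lambda>q. f q \<bullet> i) has_derivative (\<lambda>h. f' h \<bullet> i)) (at p))"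
    by (rule has_derivative_componentwise_within)
  then show ?thesis
    by (auto simp: Basis_vec_def inner_axis)
qed

lemmas has_derivative_vec_nth [derivative_intros] =
  bounded_linear.has_derivative[OF bounded_linear_vec_nth]

lemma pd_eq: "(f has_derivative f') (at p) \<Longrightarrow> pd i f p = f' (axis i 1)"
  unfolding pd_def using frechet_derivative_at by metis

lemma pd_const [simp]: "pd i (\<lambda>q. c) p = 0"
  by (subst pd_eq[OF has_derivative_const]) simp

section \<open>Smoothness of trigonometric polynomials\<close>

lemma Ck_on_subset: "Ck_on k V f \<Longrightarrow> U \<subseteq> V \<Longrightarrow> Ck_on k U f"
  by (induction k arbitrary: f) (auto intro: continuous_on_subset)

text \<open>A class closed under partial derivatives that contains the components of the
  parametrization and of its normal, so smoothness needs no formulas for higher derivatives.\<close>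

inductive trig_poly :: "(real^3 \<Rightarrow> real) \<Rightarrow> bool" where
  const: "trig_poly (\<lambda>p. c)"
| coord: "trig_poly (\<lambda>p. p $ i)"
| sin: "trig_poly (\<lambda>p. sin (p $ i))"
| cos: "trig_poly (\<lambda>p. cos (p $ i))"
| add: "trig_poly f \<Longrightarrow> trig_poly g \<Longrightarrow> trig_poly (\<lambda>p. f p + g p)"
| mult: "trig_poly f \<Longrightarrow> trig_poly g \<Longrightarrow> trig_poly (\<lambda>p. f p * g p)"

lemma trig_poly_minus: "trig_poly f \<Longrightarrow> trig_poly (\<lambda>p. - f p)"
  using trig_poly.mult[OF trig_poly.const[of "-1"]] by simp

lemma trig_poly_derivative:
  assumes "trig_poly f"
  shows "\<exists>f'. (\<forall>p. (f has_derivative f' p) (at p)) \<and> (\<forall>i. trig_poly (\<lambda>p. f' p (axis i 1)))"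
  using assms
proof induction
  case (const c)
  show ?case
    by (intro exI[of _ "\<lambda>p h. 0"]) (auto intro: trig_poly.intros)
next
  case (coord i)
  show ?case
    by (intro exI[of _ "\<lambda>p h. h $ i"]) (auto intro!: trig_poly.intros derivative_eq_intros)
next
  case (sin i)
  show ?case
    by (intro exI[of _ "\<lambda>p h. cos (p $ i) * h $ i"])
      (auto intro!: trig_poly.intros derivative_eq_intros)
next
  case (cos i)
  show ?case
    by (intro exI[of _ "\<lambda>p h. - sin (p $ i) * h $ i"])
      (auto intro!: trig_poly.intros trig_poly_minus derivative_eq_intros)
next
  case (add f g)
  then obtain f' g' where
    f: "\<And>p. (f has_derivative f' p) (at p)" "\<And>i. trig_poly (\<lambda>p. f' p (axis i 1))" and
    g: "\<And>p. (g has_derivative g' p) (at p)" "\<And>i. trig_poly (\<lambda>p. g' p (axis i 1))"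
    by metis
  show ?case
    by (intro exI[of _ "\<lambda>p h. f' p h + g' p h"] conjI allI has_derivative_add trig_poly.add f g)
next
  case (mult f g)
  then obtain f' g' where
    f: "\<And>p. (f has_derivative f' p) (at p)" "\<And>i. trig_poly (\<lambda>p. f' p (axis i 1))" and
    g: "\<And>p. (g has_derivative g' p) (at p)" "\<And>i. trig_poly (\<lambda>p. g' p (axis i 1))"
    by metis
  show ?case
    by (intro exI[of _ "\<lambda>p h. f p * g' p h + f' p h * g p"] conjI allI has_derivative_mult
        trig_poly.add trig_poly.mult f g mult)
qed

lemma trig_poly_vec_derivative:
  fixes f :: "real^3 \<Rightarrow> real^'n"
  assumes "\<And>c. trig_poly (\<lambda>q. f q $ c)"
  obtains f' where "\<And>p. (f has_derivative f' p) (at p)"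
    and "\<And>i c. trig_poly (\<lambda>p. f' p (axis i 1) $ c)"
proof -
  have "\<forall>c. \<exists>D. (\<forall>p. ((\<lambda>q. f q $ c) has_derivative D p) (at p)) \<and>
      (\<forall>i. trig_poly (\<lambda>p. D p (axis i 1)))"
    using trig_poly_derivative[OF assms] by blast
  from choice[OF this] obtain D where "\<And>c p. ((\<lambda>q. f q $ c) has_derivative D c p) (at p)"
      "\<And>c i. trig_poly (\<lambda>p. D c p (axis i 1))"
    by blast
  then show thesis
    by (intro that[of "\<lambda>p h. \<chi> c. D c p h"]) (simp_all add: has_derivative_vec_nth_iff)
qed

lemma smooth_on_trig_poly_vec:
  fixes f :: "real^3 \<Rightarrow> real^'n"
  assumes "\<And>c. trig_poly (\<lambda>q. f q $ c)"
  shows "smooth_on U f"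
proof -
  have "Ck_on k UNIV f" for k
    using assms
  \<comment> \<open>The step applies the induction hypothesis to the partial derivatives
    \<open>pd i f\<close>, hence the generalization over \<open>f\<close>.\<close>
  proof (induction k arbitrary: f)
    case (0 f)
    obtain f' where "\<And>p. (f has_derivative f' p) (at p)"
      by (rule trig_poly_vec_derivative[OF "0.prems"]) (rule that)
    then show ?case
      by (auto intro: has_derivative_continuous_on)
  next
    case (Suc k f)
    obtain f' where f': "\<And>p. (f has_derivative f' p) (at p)"
        "\<And>i c. trig_poly (\<lambda>p. f' p (axis i 1) $ c)"
      by (rule trig_poly_vec_derivative[OF Suc.prems]) (rule that)
    then have "trig_poly (\<lambda>p. pd i f p $ c)" for i c
      by (simp add: pd_eq[OF f'(1)])
    then show ?case
      using f'(1) Suc.IH by (auto simp: differentiable_def)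
  qed
  then show ?thesis
    unfolding smooth_on_def using Ck_on_subset by blast
qed

section \<open>Metric and normal of the cone\<close>

lemma lorentz_sum_right:
  "finite I \<Longrightarrow> lorentz x (\<Sum>i\<in>I. f i *\<^sub>R y i) = (\<Sum>i\<in>I. f i * lorentz x (y i))"
  by (induction rule: finite_induct) (auto simp: lorentz_def algebra_simps)

lemma vector_4_nth [simp]:
  "(vector [a, b, c, d] :: 'a::zero^4) $ 1 = a" "(vector [a, b, c, d] :: 'a^4) $ 2 = b"
  "(vector [a, b, c, d] :: 'a^4) $ 3 = c" "(vector [a, b, c, d] :: 'a^4) $ 4 = d"
  by (simp_all add: vector_def)

text \<open>Orthogonality of a plane map with angle \<open>x\<close>; it serves to eliminate the
  angles \<open>w\<close> and \<open>t\<close> from Lorentz products.\<close>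

lemma rotation_inner:
  fixes a b a' b' x :: real
  shows "(sin x * a + cos x * b) * (sin x * a' + cos x * b')
    + (cos x * a - sin x * b) * (cos x * a' - sin x * b') = a * a' + b * b'" (is "?l = ?r")
proof -
  have "?l = ((sin x)\<^sup>2 + (cos x)\<^sup>2) * ?r"
    by algebra
  then show ?thesis
    by simp
qed

text \<open>The vector \<open>(a, b Y + c Y\<^sub>t + e Y\<^sub>w)\<close>.\<close>

definition cone_frame :: "real^3 \<Rightarrow> real \<Rightarrow> real \<Rightarrow> real \<Rightarrow> real \<Rightarrow> real^4" where
  "cone_frame p a b c e = (let u = cos (p$2) * b - sin (p$2) * c; v = cos (p$2) * e in vector
     [a, - (sin (p$3) * u + cos (p$3) * v), - (sin (p$2) * b + cos (p$2) * c),
      cos (p$3) * u - sin (p$3) * v])"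

text \<open>\<open>Y\<close>, \<open>Y\<^sub>t\<close>, \<open>Y\<^sub>w\<close> are pairwise
  orthogonal with squared lengths 1, 1 and \<open>(cos (p$2))\<^sup>2\<close>.\<close>

lemma lorentz_cone_frame:
  "lorentz (cone_frame p a b c e) (cone_frame p a' b' c' e') =
    - a * a' + b * b' + c * c' + (cos (p$2))\<^sup>2 * (e * e')"
  using rotation_inner[of "p$3" "cos (p$2) * b - sin (p$2) * c" "cos (p$2) * e"
      "cos (p$2) * b' - sin (p$2) * c'" "cos (p$2) * e'"] rotation_inner[of "p$2" b c b' c']
  unfolding lorentz_def cone_frame_def Let_def vector_4_nth
  by (simp add: power2_eq_square algebra_simps)

text \<open>The product rule for \<open>s Y\<close>, read in the frame \<open>Y\<close>,
  \<open>Y\<^sub>t\<close>, \<open>Y\<^sub>w\<close>.\<close>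

lemma Gamma_has_derivative:
  "(Gamma_t d3 d4 has_derivative
    (\<lambda>h. cone_frame p (d3 * h$1) (h$1) (p$1 * h$2) (p$1 * h$3))) (at p)"
  unfolding has_derivative_vec_nth_iff forall_4 Gamma_t_def cone_frame_def Let_def vector_4_nth
  by (auto intro!: derivative_eq_intros simp: algebra_simps)

text \<open>The normal \<open>(1, d Y)\<close> before normalization; its Lorentz square is the
  constant \<open>d\<^sup>2 - 1\<close>.\<close>

abbreviation cone_normal :: "real \<Rightarrow> real^3 \<Rightarrow> real^4" where
  "cone_normal d p \<equiv> cone_frame p 1 d 0 0"

lemma cone_normal_has_derivative:
  "(cone_normal d has_derivative (\<lambda>h. cone_frame p 0 0 (d * h$2) (d * h$3))) (at p)"
  unfolding has_derivative_vec_nth_iff forall_4 cone_frame_def Let_def vector_4_nth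
  by (auto intro!: derivative_eq_intros simp: algebra_simps)

lemmas pd_Gamma = pd_eq[OF Gamma_has_derivative]

lemma axis_3_nth [simp]:
  "(axis 1 1 :: real^3) $ 1 = 1" "(axis 1 1 :: real^3) $ 2 = 0" "(axis 1 1 :: real^3) $ 3 = 0"
  "(axis 2 1 :: real^3) $ 1 = 0" "(axis 2 1 :: real^3) $ 2 = 1" "(axis 2 1 :: real^3) $ 3 = 0"
  "(axis 3 1 :: real^3) $ 1 = 0" "(axis 3 1 :: real^3) $ 2 = 0" "(axis 3 1 :: real^3) $ 3 = 1"
  by (simp_all add: axis_def)

text \<open>\<open>(1, d3 Y)\<close> is constant along the rulings, and \<open>d3 Y\<^sub>t\<close>,
  \<open>d3 Y\<^sub>w\<close> are the multiples by \<open>d3 / s\<close> of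
  \<open>s Y\<^sub>t\<close>, \<open>s Y\<^sub>w\<close>. So the coordinate directions are
  principal.\<close>

lemma pd_cone_normal:
  assumes "p$1 \<noteq> 0"
  shows "pd i (cone_normal d3) p = (if i = 1 then 0 else (d3 / p$1) *\<^sub>R pd i (Gamma_t d3 d4) p)"
proof -
  have "\<forall>i. pd i (cone_normal d3) p = (if i = 1 then 0 else (d3 / p$1) *\<^sub>R pd i (Gamma_t d3 d4) p)"
    unfolding pd_Gamma pd_eq[OF cone_normal_has_derivative] vec_eq_iff forall_3 forall_4
    using assms by (simp add: cone_frame_def Let_def)
  then show ?thesis ..
qed

section \<open>Induced metric and regularity of the parametrization\<close>

lemma metric_Gamma_nth:
  "metric (Gamma_t d3 d4) p $ i $ j = (if i \<noteq> j then 0 else if i = 1 then 1 - d3\<^sup>2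
     else if i = 2 then (p$1)\<^sup>2 else (p$1)\<^sup>2 * (cos (p$2))\<^sup>2)"
proof -
  have "\<forall>i j. metric (Gamma_t d3 d4) p $ i $ j = (if i \<noteq> j then 0 else if i = 1 then 1 - d3\<^sup>2
     else if i = 2 then (p$1)\<^sup>2 else (p$1)\<^sup>2 * (cos (p$2))\<^sup>2)"
    unfolding forall_3 metric_def pd_Gamma
    by (simp add: lorentz_cone_frame power2_eq_square)
  then show ?thesis by blast
qed

text \<open>An open set containing \<open>Gamma_dom\<close>, obtained by dropping the closed ranges
  of the angles.\<close>

abbreviation regular :: "(real^3) set" where
  "regular \<equiv> {p. p$1 \<noteq> 0 \<and> cos (p$2) \<noteq> 0}"

lemma open_regular: "open regular"
  by (intro open_Collect_conj open_Collect_neq continuous_intros)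

lemma metric_Gamma_diag_nonzero:
  assumes "p \<in> regular" "d3\<^sup>2 \<noteq> 1"
  shows "metric (Gamma_t d3 d4) p $ i $ i \<noteq> 0"
  using assms by (auto simp: metric_Gamma_nth)

lemma metric_Gamma_inverse:
  fixes d4 :: real
  assumes "p \<in> regular" "d3\<^sup>2 \<noteq> 1"
  defines "B \<equiv> \<chi> i j. if i = j then inverse (metric (Gamma_t d3 d4) p $ i $ i) else 0"
  shows "invertible (metric (Gamma_t d3 d4) p)" and "matrix_inv (metric (Gamma_t d3 d4) p) = B"
proof -
  have off: "metric (Gamma_t d3 d4) p $ i $ j = 0" if "i \<noteq> j" for i j
    using that by (simp add: metric_Gamma_nth)
  have *: "metric (Gamma_t d3 d4) p ** B = mat 1" "B ** metric (Gamma_t d3 d4) p = mat 1"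
    unfolding vec_eq_iff forall_3 B_def matrix_matrix_mult_def mat_def sum_3
    using metric_Gamma_diag_nonzero[OF assms(1,2)] off by simp_all
  then show "invertible (metric (Gamma_t d3 d4) p)"
    unfolding invertible_def by blast
  \<comment> \<open>\<open>matrix_inv\<close> is a choice among two-sided inverses; uniqueness of
    inverses identifies it with \<open>B\<close>.\<close>
  have "metric (Gamma_t d3 d4) p ** matrix_inv (metric (Gamma_t d3 d4) p) = mat 1"
    unfolding matrix_inv_def using * by (metis (mono_tags, lifting) someI)
  then show "matrix_inv (metric (Gamma_t d3 d4) p) = B"
    by (metis * matrix_mul_assoc matrix_mul_lid matrix_mul_rid)
qed

text \<open>Pairing both sides with \<open>pd m X p\<close> isolates the coefficient with index
  \<open>m\<close>, as the metric is diagonal with nonzero diagonal. This yields both the immersion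
  property and the uniqueness of the shape operator matrix.\<close>

lemma pd_Gamma_independent:
  assumes "p \<in> regular" "d3\<^sup>2 \<noteq> 1"
    and "(\<Sum>i\<in>UNIV. u i *\<^sub>R pd i (Gamma_t d3 d4) p) = (\<Sum>i\<in>UNIV. v i *\<^sub>R pd i (Gamma_t d3 d4) p)"
  shows "u m = v m"
proof -
  let ?g = "metric (Gamma_t d3 d4) p"
  have "(\<Sum>i\<in>UNIV. w i * ?g $ m $ i) = w m * ?g $ m $ m" for w
    by (subst sum.mono_neutral_right[of UNIV "{m}"]) (auto simp: metric_Gamma_nth)
  moreover have "(\<Sum>i\<in>UNIV. u i * ?g $ m $ i) = (\<Sum>i\<in>UNIV. v i * ?g $ m $ i)"
    using arg_cong[OF assms(3), of "lorentz (pd m (Gamma_t d3 d4) p)"]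
    by (simp add: lorentz_sum_right metric_def)
  ultimately show ?thesis
    using metric_Gamma_diag_nonzero[OF assms(1,2)] by simp
qed

lemma inj_Gamma_derivative:
  assumes "p \<in> regular" "d3\<^sup>2 \<noteq> 1"
  shows "inj (frechet_derivative (Gamma_t d3 d4) (at p))"
proof (rule injI)
  let ?D = "frechet_derivative (Gamma_t d3 d4) (at p)"
  fix x y assume eq: "?D x = ?D y"
  have "linear ?D"
    using Gamma_has_derivative linear_frechet_derivative unfolding differentiable_def by blast
  then have expand: "?D x = (\<Sum>i\<in>UNIV. x$i *\<^sub>R pd i (Gamma_t d3 d4) p)" for x
    unfolding pd_def by (subst basis_expansion[of x, symmetric])
      (simp add: linear_sum linear_cmul scalar_mult_eq_scaleR)
  have "x $ i = y $ i" for i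
    using eq unfolding expand by (rule pd_Gamma_independent[OF assms])
  then show "x = y"
    unfolding vec_eq_iff by blast
qed

lemma nondegenerate_immersion_Gamma:
  assumes "d3\<^sup>2 \<noteq> 1"
  shows "nondegenerate_immersion (Gamma_t d3 d4) regular"
proof -
  have "\<forall>c. trig_poly (\<lambda>q. Gamma_t d3 d4 q $ c)"
    unfolding forall_4 Gamma_t_def Let_def vector_4_nth
    by (intro conjI trig_poly.intros trig_poly_minus)
  then show ?thesis
    unfolding nondegenerate_immersion_def
    using smooth_on_trig_poly_vec inj_Gamma_derivative metric_Gamma_inverse(1) assms by blast
qed

section \<open>Existence and local form of the Gauss map\<close>

lemma lorentz_scaleR: "lorentz (a *\<^sub>R x) y = a * lorentz x y" "lorentz x (a *\<^sub>R y) = a * lorentz x y"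
  by (simp_all add: lorentz_def algebra_simps)

lemma lorentz_cone_normal_pd: "lorentz (cone_normal d3 p) (pd i (Gamma_t d3 d4) p) = 0"
  unfolding pd_Gamma lorentz_cone_frame by simp

text \<open>A constant factor normalizes \<open>cone_normal d3\<close>. The absolute value under the
  root treats spacelike and timelike normals together, the sign of \<open>d3\<^sup>2 - 1\<close>
  being the resulting square.\<close>

lemma gauss_map_Gamma:
  assumes "d3\<^sup>2 \<noteq> 1"
  shows "gauss_map (Gamma_t d3 d4) Gamma_dom (\<lambda>p. (1 / sqrt \<bar>d3\<^sup>2 - 1\<bar>) *\<^sub>R cone_normal d3 p)"
proof -
  let ?N = "\<lambda>p. (1 / sqrt \<bar>d3\<^sup>2 - 1\<bar>) *\<^sub>R cone_normal d3 p"
  have "\<forall>c. trig_poly (\<lambda>q. ?N q $ c)"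
    unfolding forall_4 cone_frame_def Let_def diff_conv_add_uminus
      vector_scaleR_component vector_4_nth real_scaleR_def
    by (intro conjI trig_poly.intros trig_poly_minus)
  moreover have "lorentz (?N p) (?N p) = sgn (d3\<^sup>2 - 1)" for p
    using assms by (simp add: lorentz_scaleR lorentz_cone_frame power2_eq_square real_div_sqrt sgn_real_def
        field_simps)
  then have "lorentz (?N p) (?N p) \<in> {1, -1}" for p
    using assms by (simp add: sgn_real_def)
  ultimately have "unit_normal_field (Gamma_t d3 d4) regular ?N"
    unfolding unit_normal_field_def
    by (auto intro: smooth_on_trig_poly_vec simp: lorentz_scaleR lorentz_cone_normal_pd)
  moreover have "Gamma_dom \<subseteq> regular"
    by (auto simp: Gamma_dom_def)
  ultimately show ?thesis
    unfolding gauss_map_def using open_regular nondegenerate_immersion_Gamma[OF assms] by blast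
qed

text \<open>The three orthogonality conditions are linear equations whose solutions form a line. The
  factor is \<open>v$1\<close> because \<open>cone_normal\<close> has first component 1.\<close>

lemma normal_eq_cone_normal:
  assumes "p \<in> regular" and orth: "\<forall>i. lorentz v (pd i (Gamma_t d3 d4) p) = 0"
  shows "v = v$1 *\<^sub>R cone_normal d3 p"
proof -
  define st ct sw cw where "st = sin (p$2)" "ct = cos (p$2)" "sw = sin (p$3)" "cw = cos (p$3)"
  note defs = this
  have sc: "ct\<^sup>2 = 1 - st\<^sup>2" "cw\<^sup>2 = 1 - sw\<^sup>2"
    by (simp_all add: cos_squared_eq defs)
  have nz: "p$1 \<noteq> 0" "ct \<noteq> 0" using assms(1) by (auto simp: defs)
  \<comment> \<open>Components 2 and 4 of \<open>v\<close> are rotated by the angle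
    \<open>w\<close>: \<open>u\<close> is one new coordinate, and orthogonality to the third tangent
    vector makes the other vanish. Then \<open>u\<close> and \<open>v$3\<close> solve a rotation
    system in the angle \<open>t\<close>.\<close>
  define u where "u = cw * v$4 - sw * v$2"
  have 1: "- d3 * v$1 + ct * u - st * v$3 = 0"
    using orth[rule_format, of 1] unfolding pd_Gamma
    by (simp add: lorentz_def cone_frame_def Let_def defs[symmetric] u_def algebra_simps)
  have "p$1 * (st * u + ct * v$3) = 0"
    using orth[rule_format, of 2] unfolding pd_Gamma
    by (simp add: lorentz_def cone_frame_def Let_def defs[symmetric] u_def algebra_simps)
  then have 2: "st * u + ct * v$3 = 0" using nz by simp
  have "p$1 * ct * (cw * v$2 + sw * v$4) = 0"
    using orth[rule_format, of 3] unfolding pd_Gamma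
    by (simp add: lorentz_def cone_frame_def Let_def defs[symmetric] algebra_simps)
  then have 3: "cw * v$2 + sw * v$4 = 0" using nz by simp
  have u: "u = d3 * v$1 * ct" using 1 2 sc by algebra
  have "v$3 = - d3 * v$1 * st" using 1 2 sc by algebra
  moreover have "v$2 = - sw * u" unfolding u_def using 3 sc by algebra
  moreover have "v$4 = cw * u" unfolding u_def using 3 sc by algebra
  ultimately show ?thesis
    unfolding vec_eq_iff forall_4 cone_frame_def Let_def by (simp add: u defs)
qed

text \<open>The first component of \<open>N\<close> is continuous and takes at most two values, so it is locally
  constant.\<close>

lemma gauss_map_locally:
  assumes N: "gauss_map (Gamma_t d3 d4) Gamma_dom N" and p: "p \<in> Gamma_dom"
  obtains W where "open W" "p \<in> W" "W \<subseteq> regular" "\<And>q. q \<in> W \<Longrightarrow> N q = N p $ 1 *\<^sub>R cone_normal d3 q"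
proof -
  obtain U where U: "open U" "Gamma_dom \<subseteq> U" "unit_normal_field (Gamma_t d3 d4) U N"
    using N unfolding gauss_map_def by blast
  define V where "V = U \<inter> regular"
  have V: "open V" "p \<in> V"
    using U p open_regular by (auto simp: V_def Gamma_dom_def)
  have eq: "N q = N q $ 1 *\<^sub>R cone_normal d3 q" if "q \<in> V" for q
    using that U(3) normal_eq_cone_normal unfolding V_def unit_normal_field_def by blast
  have sq: "(N q $ 1)\<^sup>2 * \<bar>d3\<^sup>2 - 1\<bar> = 1" if "q \<in> V" for q
  proof -
    have "lorentz (N q) (N q) = (N q $ 1)\<^sup>2 * (d3\<^sup>2 - 1)"
      by (subst (1 2) eq[OF that]) (simp add: lorentz_scaleR lorentz_cone_frame power2_eq_square)
    moreover have "lorentz (N q) (N q) \<in> {1, -1}"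
      using that U(3) unfolding V_def unit_normal_field_def by blast
    ultimately have "\<bar>(N q $ 1)\<^sup>2 * (d3\<^sup>2 - 1)\<bar> = 1"
      by auto
    then show ?thesis
      by (simp add: abs_mult)
  qed
  have "continuous_on U N"
    using U(3) unfolding unit_normal_field_def smooth_on_def by (metis Ck_on.simps(1))
  then have cont: "continuous_on V (\<lambda>q. N q $ 1)"
    by (intro continuous_intros) (auto simp: V_def intro: continuous_on_subset)
  \<comment> \<open>On \<open>V\<close> the first component is \<open>N p $ 1\<close> or its
    negative; \<open>W\<close> discards the points with the negative value.\<close>
  define W where "W = V \<inter> (\<lambda>q. N q $ 1) -` (- {- N p $ 1})"
  have W1: "open W"
    unfolding W_def by (rule continuous_open_preimage[OF cont V(1)]) auto
  \<comment> \<open>A product equal to 1 has nonzero factors.\<close>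
  have nz: "N p $ 1 \<noteq> 0" "d3\<^sup>2 - 1 \<noteq> 0"
    using sq[OF V(2)] by auto
  have W2: "p \<in> W"
    using nz V by (auto simp: W_def)
  have W3: "N q = N p $ 1 *\<^sub>R cone_normal d3 q" if "q \<in> W" for q
  proof -
    have q: "q \<in> V" "N q $ 1 \<noteq> - N p $ 1" using that by (auto simp: W_def)
    have "(N q $ 1)\<^sup>2 * \<bar>d3\<^sup>2 - 1\<bar> = (N p $ 1)\<^sup>2 * \<bar>d3\<^sup>2 - 1\<bar>"
      using sq q V by simp
    then have "(N q $ 1)\<^sup>2 = (N p $ 1)\<^sup>2"
      using nz by simp
    then have "N q $ 1 = N p $ 1"
      using q(2) unfolding power2_eq_iff by simp
    then show ?thesis
      using eq[OF q(1)] by simp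
  qed
  have "W \<subseteq> regular"
    by (auto simp: W_def V_def)
  from W1 W2 this W3 show thesis
    by (rule that)
qed

section \<open>The operator \<open>L\<^sub>2\<close>\<close>

text \<open>The coefficients are read off the characteristic polynomial
  \<open>x * (x - k)\<^sup>2\<close>, which avoids the chosen list of complex eigenvalues. The
  entries of \<open>P\<^sub>2\<close> at eigenvalue \<open>k\<close> cancel as
  \<open>k\<^sup>2 - 2 * k\<^sup>2 + k\<^sup>2\<close>.\<close>

lemma newton_transformation_2_diag:
  fixes k :: real
  defines "A \<equiv> \<chi> i j. if i = j \<and> i \<noteq> 1 then k else 0"
  shows "newton_transformation 2 A = (\<chi> i j. if i = 1 \<and> j = 1 then k\<^sup>2 else 0)"
proof -
  have "x^3 + a_coeff A 1 * x^2 + a_coeff A 2 * x + a_coeff A 3 = x * (x - k)\<^sup>2" for x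
    unfolding charpoly_a_coeff[symmetric]
    by (simp add: det_3 mat_def A_def power2_eq_square)
  \<comment> \<open>Three values of the argument determine the three coefficients.\<close>
  from this[of 0] this[of 1] this[of "-1"]
  have a: "a_coeff A 1 = - 2 * k" "a_coeff A 2 = k\<^sup>2"
    by (simp_all add: power2_eq_square algebra_simps)
  have "newton_transformation 2 A =
      a_coeff A 2 *\<^sub>R mat 1 + A ** (a_coeff A 1 *\<^sub>R mat 1 + A ** mat 1)"
    by (simp add: numeral_2_eq_2)
  then show ?thesis
    unfolding a vec_eq_iff forall_3
    by (simp add: A_def matrix_matrix_mult_def sum_3 mat_def power2_eq_square)
qed

theorem theorem13:
  fixes d3 d4 :: real
  assumes "d3 \<noteq> 1" and "d3 \<noteq> -1"
  shows "(\<exists>N. gauss_map (Gamma_t d3 d4) Gamma_dom N) \<and>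
    (\<forall>N. gauss_map (Gamma_t d3 d4) Gamma_dom N \<longrightarrow>
      (\<forall>p\<in>Gamma_dom. L_vec 2 (Gamma_t d3 d4) N N p = 0))"
proof (intro conjI allI impI ballI)
  have d3: "d3\<^sup>2 \<noteq> 1"
    using assms by (simp add: power2_eq_1_iff)
  then show "\<exists>N. gauss_map (Gamma_t d3 d4) Gamma_dom N"
    using gauss_map_Gamma by blast
  fix N p
  assume "gauss_map (Gamma_t d3 d4) Gamma_dom N" "p \<in> Gamma_dom"
  then obtain W where W: "open W" "p \<in> W" "W \<subseteq> regular"
      and NW: "\<And>q. q \<in> W \<Longrightarrow> N q = N p $ 1 *\<^sub>R cone_normal d3 q"
    by (rule gauss_map_locally) (rule that)
  let ?X = "Gamma_t d3 d4"
  define k where "k = - (N p $ 1 * d3 / p$1)"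
  \<comment> \<open>The formula for \<open>N\<close> holds on the open set \<open>W\<close>, so it
    may be differentiated at every point of \<open>W\<close>; the Hessian needs the first
    derivatives near \<open>p\<close>, not only at \<open>p\<close>.\<close>
  have N': "(N has_derivative (\<lambda>h. N p $ 1 *\<^sub>R cone_frame q 0 0 (d3 * h$2) (d3 * h$3))) (at q)"
    if "q \<in> W" for q
    by (rule has_derivative_transform_within_open[OF _ W(1) that])
      (auto intro: cone_normal_has_derivative has_derivative_scaleR_right simp: NW)
  have pdN: "pd j N q = N p $ 1 *\<^sub>R pd j (cone_normal d3) q" if "q \<in> W" for j q
    by (simp add: pd_eq[OF N'[OF that]] pd_eq[OF cone_normal_has_derivative])
  have p: "p \<in> regular" "p$1 \<noteq> 0"
    using W by auto
  have shape: "shape_operator ?X N p = (\<chi> i j. if i = j \<and> i \<noteq> 1 then k else 0)" (is "_ = ?A")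
    unfolding shape_operator_def
  proof (rule the_equality)
    show A: "\<forall>j. - pd j N p = (\<Sum>i\<in>UNIV. ?A $ i $ j *\<^sub>R pd i ?X p)"
      unfolding forall_3 sum_3 pdN[OF W(2)] pd_cone_normal[OF p(2), of _ d3 d4] by (simp add: k_def)
    fix B assume "\<forall>j. - pd j N p = (\<Sum>i\<in>UNIV. B $ i $ j *\<^sub>R pd i ?X p)"
    with A have "(\<Sum>i\<in>UNIV. B $ i $ j *\<^sub>R pd i ?X p) = (\<Sum>i\<in>UNIV. ?A $ i $ j *\<^sub>R pd i ?X p)" for j
      by metis
    then have "B $ i $ j = ?A $ i $ j" for i j
      by (rule pd_Gamma_independent[OF p(1) d3])
    then show "B = ?A"
      unfolding vec_eq_iff by blast
  qed
  have "hessian_operator ?X (\<lambda>q. N q $ c) p $ 1 $ 1 = 0" for c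
  proof -
    \<comment> \<open>\<open>N\<close> does not depend on \<open>s\<close> on \<open>W\<close>, and
      the diagonal inverse metric mixes no other derivative into the first component.\<close>
    have grad: "gradient ?X (\<lambda>q. N q $ c) q $ 1 = 0" if "q \<in> W" for q
    proof -
      have "((\<lambda>r. N r $ c) has_derivative
          (\<lambda>h. (N p $ 1 *\<^sub>R cone_frame q 0 0 (d3 * h$2) (d3 * h$3)) $ c)) (at q)"
        using N'[OF that] unfolding has_derivative_vec_nth_iff by blast
      from pd_eq[OF this, of 1] have "pd 1 (\<lambda>r. N r $ c) q = (pd 1 N q) $ c"
        by (simp add: pd_eq[OF N'[OF that]])
      also have "\<dots> = 0"
        using that W by (subst pdN) (auto simp: pd_cone_normal[of q 1 d3 d4])
      finally show ?thesis
        using that W metric_Gamma_inverse(2)[OF _ d3, of q d4]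
        by (auto simp: gradient_def matrix_vector_mult_def sum_3)
    qed
    have "((\<lambda>q. gradient ?X (\<lambda>q. N q $ c) q $ 1) has_derivative (\<lambda>h. 0)) (at p)"
      by (rule has_derivative_transform_within_open[OF has_derivative_const W(1,2)]) (simp add: grad)
    from pd_eq[OF this] have "pd 1 (\<lambda>q. gradient ?X (\<lambda>q. N q $ c) q $ 1) p = 0"
      by simp
    \<comment> \<open>Only \<open>m = 1\<close> contributes; the two derivatives of
      \<open>g\<^sub>1\<^sub>l\<close> cancel, leaving that of the constant
      \<open>g\<^sub>1\<^sub>1 = 1 - d3\<^sup>2\<close>.\<close>
    moreover have "christoffel ?X 1 1 l p = 0" for l
      unfolding christoffel_def metric_Gamma_inverse(2)[OF p(1) d3]
      by (simp add: sum_3 metric_Gamma_nth)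
    ultimately show ?thesis
      by (simp add: hessian_operator_def cov_deriv_def)
  qed
  \<comment> \<open>The trace reduces to \<open>k\<^sup>2\<close> times the (1, 1) entry of the
    Hessian operator.\<close>
  then show "L_vec 2 ?X N N p = 0"
    unfolding L_vec_def L_op_def shape newton_transformation_2_diag
    by (simp add: vec_eq_iff trace_def matrix_matrix_mult_def sum_3)
qed

end
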